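(* Let $X=(X_1,\dots,X_n)\in\{0,1\}^n$ be a random vector with a signed $\mathrm{MTP}_2$ law. Then for every $\varepsilon>0$ there exists $t=O(1/\varepsilon)$ such that $$\mathrm{avgCov}_{\mid t}(X)\le\varepsilon.$$
   Context: Write $[n]=\{1,\dots,n\}$. A probability measure $\mu$ on $\{0,1\}^n$ is multivariate totally positive of order two ($\mathrm{MTP}_2$) if $\mu(\min\{x,y\})\,\mu(\max\{x,y\})\ge\mu(x)\mu(y)$ for all $x,y\in\{0,1\}^n$, where $\min$ and $\max$ are taken coordinatewise. The law of $X$ is signed $\mathrm{MTP}_2$ if there exist $\varepsilon_1,\dots,\varepsilon_n\in\{0,1\}$ such that the random vector $Y=(Y_1,\dots,Y_n)$, with $Y_i=X_i$ if $\varepsilon_i=0$ and $Y_i=1-X_i$ if $\varepsilon_i=1$, has an $\mathrm{MTP}_2$ law. For $J\subset[n]$, write $X_J=(X_k)_{k\in J}$. Define $$\mathrm{avgCov}_{\mid t}(X)=\operatorname*{avg}_{\substack{J\subset[n]\\|J|=t}}\ \operatorname*{avg}_{\substack{i,j\in[n]\setminus J\\ i\neq j}}\ \mathbb{E}\left[\left|\mathrm{Cov}\left(X_i,X_j\,\middle|\,X_J\right)\right|\right],$$ where $\operatorname{avg}$ denotes the uniform average over the indicated finite set, and $\mathrm{Cov}(X_i,X_j\mid X_J)$ is the conditional covariance of $X_i$ and $X_j$ given $X_J$. The statement that such a $t$ exists for every $\varepsilon>0$ is a conjecture of Allen, O'Donnell, and Zhou (their Conjecture A), which is false for general laws on $\{0,1\}^n$;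 the claim is that it holds for signed $\mathrm{MTP}_2$ laws.
   Formalization: An average over no pairs counts as 0, so t = n−1 or n (allowed by t ≤ n) satisfies the bound trivially when n < C/ε + 2; without this the claim fails for n = 2, X_1 = X_2 a fair coin, ε < 1/4. For n ≥ C/ε + 2 the averages are genuine. *)

theory Defs
  imports "HOL-Probability.Probability"
begin

text \<open>
  A random vector in \<open>{0,1}\<^sup>n\<close> is given by its law, a \<open>pmf\<close> on functions supported on
  \<open>cube n\<close>; the coordinate \<open>X\<^sub>i\<close> is the evaluation \<open>\<lambda>x. x i\<close>.
\<close>

definition cube :: "nat \<Rightarrow> (nat \<Rightarrow> real) set" where
  "cube n = {1..n} \<rightarrow>\<^sub>E {0, 1}"

definition mtp2 :: "nat \<Rightarrow> (nat \<Rightarrow> real) pmf \<Rightarrow> bool" where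
  "mtp2 n \<mu> \<longleftrightarrow>
     (\<forall>x\<in>cube n. \<forall>y\<in>cube n.
        pmf \<mu> (\<lambda>i\<in>{1..n}. min (x i) (y i)) * pmf \<mu> (\<lambda>i\<in>{1..n}. max (x i) (y i))
          \<ge> pmf \<mu> x * pmf \<mu> y)"

definition flip :: "nat \<Rightarrow> (nat \<Rightarrow> nat) \<Rightarrow> (nat \<Rightarrow> real) \<Rightarrow> (nat \<Rightarrow> real)" where
  "flip n e x = (\<lambda>i\<in>{1..n}. if e i = 0 then x i else 1 - x i)"

definition signed_mtp2 :: "nat \<Rightarrow> (nat \<Rightarrow> real) pmf \<Rightarrow> bool" where
  "signed_mtp2 n p \<longleftrightarrow> (\<exists>e \<in> {1..n} \<rightarrow> {0, 1}. mtp2 n (map_pmf (flip n e) p))"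

definition covariance :: "'a pmf \<Rightarrow> ('a \<Rightarrow> real) \<Rightarrow> ('a \<Rightarrow> real) \<Rightarrow> real" where
  "covariance q f g =
     measure_pmf.expectation q
       (\<lambda>y. (f y - measure_pmf.expectation q f) * (g y - measure_pmf.expectation q g))"

text \<open>
  The value of \<open>Cov(X\<^sub>i, X\<^sub>j | X\<^sub>J)\<close> at the outcome \<open>x\<close>, that is, on the event \<open>X\<^sub>J = x\<^sub>J\<close>. It is
  meaningful for \<open>x\<close> in the support of \<open>p\<close>, where that event has positive probability.
\<close>

definition cond_cov ::
    "(nat \<Rightarrow> real) pmf \<Rightarrow> nat \<Rightarrow> nat \<Rightarrow> nat set \<Rightarrow> (nat \<Rightarrow> real) \<Rightarrow> real" where
  "cond_cov p i j J x =
     covariance (cond_pmf p {y. \<forall>k\<in>J. y k = x k}) (\<lambda>y. y i) (\<lambda>y. y j)"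

definition avg :: "'a set \<Rightarrow> ('a \<Rightarrow> real) \<Rightarrow> real" where
  "avg A f = (\<Sum>a\<in>A. f a) / real (card A)"

text \<open>
  An average over the empty set is \<open>0\<close>. For \<open>t \<le> n\<close> this convention is used only when
  \<open>t \<in> {n - 1, n}\<close>: then at most one coordinate is left outside \<open>J\<close> and there is no pair to
  average over. A bound \<open>t \<le> C / \<epsilon>\<close> excludes this case as soon as \<open>n \<ge> C / \<epsilon> + 2\<close>. For smaller
  \<open>n\<close> some convention is needed: if \<open>n = 2\<close>, only \<open>t = 0\<close> leaves a pair, and the single
  covariance need not be small.
\<close>

definition avgCov :: "nat \<Rightarrow> (nat \<Rightarrow> real) pmf \<Rightarrow> nat \<Rightarrow> real" where
  "avgCov n p t =
     avg {J. J \<subseteq> {1..n} \<and> card J = t}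
       (\<lambda>J. avg {(i, j). i \<in> {1..n} - J \<and> j \<in> {1..n} - J \<and> i \<noteq> j}
         (\<lambda>(i, j). measure_pmf.expectation p (\<lambda>x. \<bar>cond_cov p i j J x\<bar>)))"

end

theory Submission
  imports Defs
begin

text \<open>
  For a signed \<open>MTP\<^sub>2\<close> law the four functions theorem gives signs \<open>s\<^sub>i\<close> with
  \<open>s\<^sub>i s\<^sub>j Cov(X\<^sub>i, X\<^sub>j | X\<^sub>J) \<ge> 0\<close> for all \<open>J\<close>, so the absolute conditional covariances sum up to at most
  \<open>V(J) = E Var(S | X\<^sub>J)\<close>, where \<open>S = \<Sum>\<^sub>i s\<^sub>i X\<^sub>i\<close>. Revealing one more coordinate \<open>X\<^sub>k\<close> lowers \<open>V\<close> by at
  least \<open>4 E Cov(S, X\<^sub>k | X\<^sub>J)\<^sup>2\<close>, and \<open>\<Sum>\<^sub>k s\<^sub>k E Cov(S, X\<^sub>k | X\<^sub>J) = V(J)\<close>. Hence the average \<open>V\<^sub>t\<close> of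
  \<open>V(J)\<close> over \<open>|J| = t\<close> satisfies \<open>V\<^sub>t\<^sub>+\<^sub>1 \<le> V\<^sub>t - 4 V\<^sub>t\<^sup>2 / n\<^sup>2\<close>, which forces \<open>V\<^sub>t \<le> n\<^sup>2 / (4 (t + 1))\<close>.
  This bounds \<open>avgCov\<close> by \<open>1 / (t + 1)\<close> as long as \<open>2 t + 2 \<le> n\<close>; for larger \<open>t\<close> one reveals all
  coordinates instead.
\<close>

subsection \<open>The four functions theorem\<close>

text \<open>This is the one-point case of the four functions theorem. The products
  \<open>a0 * b0\<close> and \<open>a1 * b1\<close> are bounded separately; the mixed ones
  \<open>u\<close> and \<open>v\<close> are both at most \<open>P\<close> and satisfy
  \<open>u * v \<le> P * Q\<close>, so expanding \<open>0 \<le> (P - u) * (P - v)\<close> bounds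
  \<open>u + v\<close> by \<open>P + Q\<close>.\<close>

lemma four_reals_le:
  fixes a0 a1 b0 b1 c0 c1 d0 d1 :: real
  assumes nn: "0 \<le> a0" "0 \<le> a1" "0 \<le> b0" "0 \<le> b1" "0 \<le> c0" "0 \<le> c1" "0 \<le> d0" "0 \<le> d1"
    and h00: "a0 * b0 \<le> c0 * d0" and h01: "a0 * b1 \<le> c1 * d0"
    and h10: "a1 * b0 \<le> c1 * d0" and h11: "a1 * b1 \<le> c1 * d1"
  shows "(a0 + a1) * (b0 + b1) \<le> (c0 + c1) * (d0 + d1)"
proof -
  define P where "P = c1 * d0"
  define Q where "Q = c0 * d1"
  define u where "u = a0 * b1"
  define v where "v = a1 * b0"
  have P0: "0 \<le> P" "0 \<le> Q" using nn by (auto simp: P_def Q_def)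
  have uP: "u \<le> P" "v \<le> P" using h01 h10 by (auto simp: P_def u_def v_def)
  have uv: "u * v \<le> P * Q"
  proof -
    have "(a0 * b0) * (a1 * b1) \<le> (c0 * d0) * (c1 * d1)"
      using nn by (intro mult_mono[OF h00 h11]) auto
    then show ?thesis by (simp add: u_def v_def P_def Q_def algebra_simps)
  qed
  have "u + v \<le> P + Q"
  proof (cases "P = 0")
    case True
    then show ?thesis using uP P0 by linarith
  next
    case False
    then have "P > 0" using P0 by simp
    have "0 \<le> (P - u) * (P - v)" using uP by simp
    then have "P * (u + v) \<le> P * (P + Q)" using uv by (simp add: algebra_simps)
    then show ?thesis using \<open>P > 0\<close> by simp
  qed
  then show ?thesis using h00 h11 by (simp add: u_def v_def P_def Q_def algebra_simps)
qed

lemma sum_Pow_insert: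
  fixes f :: "'a set \<Rightarrow> 'b::comm_monoid_add"
  assumes "finite S" "z \<notin> S"
  shows "sum f (Pow (insert z S)) = (\<Sum>A\<in>Pow S. f A + f (insert z A))"
proof -
  have inj: "inj_on (insert z) (Pow S)"
    using assms(2) by (force simp: inj_on_def)
  have "sum f (Pow (insert z S)) = sum f (Pow S) + sum f (insert z ` Pow S)"
    unfolding Pow_insert using assms by (intro sum.union_disjoint) auto
  also have "sum f (insert z ` Pow S) = (\<Sum>A\<in>Pow S. f (insert z A))"
    using sum.reindex[OF inj] by simp
  finally show ?thesis by (simp add: sum.distrib)
qed

text \<open>Induction on \<open>S\<close>: each function is replaced by its sum over the two choices
  of having \<open>z\<close> or not. By \<open>four_reals_le\<close> these sums satisfy the same
  hypothesis on the smaller set, which is why the four functions stay arbitrary in the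
  induction.\<close>

lemma four_functions:
  fixes \<alpha> \<beta> \<gamma> \<delta> :: "'a set \<Rightarrow> real"
  assumes "finite S"
    and "\<And>A. 0 \<le> \<alpha> A" "\<And>A. 0 \<le> \<beta> A" "\<And>A. 0 \<le> \<gamma> A" "\<And>A. 0 \<le> \<delta> A"
    and "\<And>A B. A \<subseteq> S \<Longrightarrow> B \<subseteq> S \<Longrightarrow> \<alpha> A * \<beta> B \<le> \<gamma> (A \<union> B) * \<delta> (A \<inter> B)"
  shows "sum \<alpha> (Pow S) * sum \<beta> (Pow S) \<le> sum \<gamma> (Pow S) * sum \<delta> (Pow S)"
  using assms
proof (induction S arbitrary: \<alpha> \<beta> \<gamma> \<delta> rule: finite_induct)
  case empty
  from empty(5)[of "{}" "{}"] show ?case by simp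
next
  case (insert z S)
  note h = insert.prems(5)
  have "(\<Sum>A\<in>Pow S. \<alpha> A + \<alpha> (insert z A)) * (\<Sum>A\<in>Pow S. \<beta> A + \<beta> (insert z A))
      \<le> (\<Sum>A\<in>Pow S. \<gamma> A + \<gamma> (insert z A)) * (\<Sum>A\<in>Pow S. \<delta> A + \<delta> (insert z A))"
  proof (rule insert.IH)
    fix A B assume AB: "A \<subseteq> S" "B \<subseteq> S"
    then have z: "z \<notin> A" "z \<notin> B" using insert.hyps by auto
    have e: "A \<inter> insert z B = A \<inter> B" "insert z A \<inter> B = A \<inter> B"
      "insert z A \<union> insert z B = insert z (A \<union> B)"
      "insert z A \<inter> insert z B = insert z (A \<inter> B)" using z by auto
    have sub: "A \<subseteq> insert z S" "insert z A \<subseteq> insert z S"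
      "B \<subseteq> insert z S" "insert z B \<subseteq> insert z S" using AB by auto
    have "\<alpha> A * \<beta> (insert z B) \<le> \<gamma> (insert z (A \<union> B)) * \<delta> (A \<inter> B)"
      using h[OF sub(1) sub(4)] e by simp
    moreover have "\<alpha> (insert z A) * \<beta> B \<le> \<gamma> (insert z (A \<union> B)) * \<delta> (A \<inter> B)"
      using h[OF sub(2) sub(3)] e by simp
    moreover have "\<alpha> (insert z A) * \<beta> (insert z B)
        \<le> \<gamma> (insert z (A \<union> B)) * \<delta> (insert z (A \<inter> B))"
      using h[OF sub(2) sub(4)] unfolding e .
    ultimately show "(\<alpha> A + \<alpha> (insert z A)) * (\<beta> B + \<beta> (insert z B))
      \<le> (\<gamma> (A \<union> B) + \<gamma> (insert z (A \<union> B))) * (\<delta> (A \<inter> B) + \<delta> (insert z (A \<inter> B)))"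
      using h[OF sub(1) sub(3)] insert.prems(1-4) by (intro four_reals_le) auto
  qed (use insert.prems in auto)
  then show ?case by (simp add: sum_Pow_insert insert.hyps)
qed

subsection \<open>Covariances of finitely supported laws\<close>

lemma integrable_finite_pmf:
  fixes f :: "'a \<Rightarrow> real"
  assumes "finite (set_pmf q)"
  shows "integrable (measure_pmf q) f"
  using assms by (rule integrable_measure_pmf_finite)

lemma covariance_eq:
  assumes "finite (set_pmf q)"
  shows "covariance q f g = measure_pmf.expectation q (\<lambda>y. f y * g y)
    - measure_pmf.expectation q f * measure_pmf.expectation q g"
proof -
  have "(\<lambda>y. (f y - measure_pmf.expectation q f) * (g y - measure_pmf.expectation q g))
    = (\<lambda>y. f y * g y - measure_pmf.expectation q g * f y - measure_pmf.expectation q f * g y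
        + measure_pmf.expectation q f * measure_pmf.expectation q g)"
    by (simp add: algebra_simps)
  then show ?thesis
    unfolding covariance_def by (simp add: integrable_finite_pmf[OF assms])
qed

lemma covariance_commute: "covariance q f g = covariance q g f"
  by (simp add: covariance_def mult.commute)

lemma covariance_sum_right:
  assumes "finite (set_pmf q)"
  shows "covariance q f (\<lambda>y. \<Sum>i\<in>I. g i y) = (\<Sum>i\<in>I. covariance q f (g i))"
  by (simp add: covariance_eq[OF assms] integrable_finite_pmf[OF assms] sum_distrib_left
      sum_subtractf)

lemma covariance_affine:
  fixes f g :: "'a \<Rightarrow> real"
  assumes "finite (set_pmf q)"
  shows "covariance q (\<lambda>y. a * f y + b) (\<lambda>y. c * g y + d) = a * c * covariance q f g"
proof -
  have "measure_pmf.expectation q (\<lambda>y. (a * f y + b) * (c * g y + d))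
      = a * c * measure_pmf.expectation q (\<lambda>y. f y * g y) + a * d * measure_pmf.expectation q f
        + b * c * measure_pmf.expectation q g + b * d"
  proof -
    have "(\<lambda>y. (a * f y + b) * (c * g y + d))
      = (\<lambda>y. a * c * (f y * g y) + a * d * f y + b * c * g y + b * d)"
      by (simp add: algebra_simps)
    then show ?thesis by (simp add: integrable_finite_pmf[OF assms])
  qed
  then show ?thesis
    by (simp add: covariance_eq[OF assms] integrable_finite_pmf[OF assms] algebra_simps)
qed

lemma covariance_cong:
  assumes "\<And>y. y \<in> set_pmf q \<Longrightarrow> f y = f' y" "\<And>y. y \<in> set_pmf q \<Longrightarrow> g y = g' y"
  shows "covariance q f g = covariance q f' g'"
proof -
  have "measure_pmf.expectation q f = measure_pmf.expectation q f'"
    "measure_pmf.expectation q g = measure_pmf.expectation q g'"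
    using assms by (auto intro!: integral_cong_AE simp: AE_measure_pmf_iff)
  then show ?thesis
    unfolding covariance_def using assms
    by (auto intro!: integral_cong_AE simp: AE_measure_pmf_iff)
qed

lemma covariance_const:
  assumes "\<And>y. y \<in> set_pmf q \<Longrightarrow> g y = c"
  shows "covariance q f g = 0"
proof -
  have "covariance q f g = covariance q f (\<lambda>_. c)"
    using assms by (intro covariance_cong) auto
  then show ?thesis by (simp add: covariance_def)
qed

lemma covariance_map_pmf:
  "covariance (map_pmf h q) f g = covariance q (\<lambda>y. f (h y)) (\<lambda>y. g (h y))"
  by (simp add: covariance_def)

lemma covariance_self_nonneg: "0 \<le> covariance q f f"
  unfolding covariance_def by (intro integral_nonneg_AE) (simp add: AE_measure_pmf_iff)

text \<open>The mean is the best constant predictor: the two sides differ by the square of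
  \<open>c\<close> minus the mean.\<close>

lemma covariance_self_le:
  assumes "finite (set_pmf q)"
  shows "covariance q f f \<le> measure_pmf.expectation q (\<lambda>y. (f y - c)\<^sup>2)"
proof -
  have "(\<lambda>y. (f y - c)\<^sup>2) = (\<lambda>y. f y * f y - 2 * c * f y + c\<^sup>2)"
    by (simp add: power2_eq_square algebra_simps)
  then have "measure_pmf.expectation q (\<lambda>y. (f y - c)\<^sup>2) - covariance q f f
      = (measure_pmf.expectation q f - c)\<^sup>2"
    by (simp add: covariance_eq[OF assms] integrable_finite_pmf[OF assms])
       (simp add: power2_eq_square algebra_simps)
  then show ?thesis by (smt (verit) zero_le_power2)
qed

text \<open>A binary variable has distance exactly 1/2 from the centre 1/2, so predicting it by 1/2
  costs 1/4.\<close>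

lemma covariance_self_binary_le:
  assumes "finite (set_pmf q)" "\<And>y. y \<in> set_pmf q \<Longrightarrow> f y \<in> {0, 1}"
  shows "covariance q f f \<le> 1 / 4"
proof -
  have "(f y - 1 / 2)\<^sup>2 = 1 / 4" if "y \<in> set_pmf q" for y
    using assms(2)[OF that] by (auto simp: power2_eq_square)
  then have "measure_pmf.expectation q (\<lambda>y. (f y - 1 / 2)\<^sup>2) = measure_pmf.expectation q (\<lambda>y. 1 / 4)"
    by (intro integral_cong_AE) (auto simp: AE_measure_pmf_iff)
  then show ?thesis using covariance_self_le[OF assms(1), of f "1 / 2"] by simp
qed

text \<open>
  The slope \<open>b\<close> is that of the best linear predictor of \<open>f\<close> from \<open>g\<close> when \<open>g\<close> has the largest possible
  variance \<open>1 / 4\<close>; this avoids dividing by a variance that may vanish.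
\<close>

lemma expectation_residual_le:
  assumes fin: "finite (set_pmf q)" and g: "covariance q g g \<le> 1 / 4"
    and b: "b = 4 * covariance q f g"
    and a: "a = measure_pmf.expectation q f - b * measure_pmf.expectation q g"
  shows "measure_pmf.expectation q (\<lambda>y. (f y - (a + b * g y))\<^sup>2)
    \<le> covariance q f f - 4 * (covariance q f g)\<^sup>2"
proof -
  let ?E = "measure_pmf.expectation q"
  have "?E (\<lambda>y. (f y - (a + b * g y))\<^sup>2)
      = covariance q f f - 2 * b * covariance q f g + b\<^sup>2 * covariance q g g"
  proof -
    have "(\<lambda>y. (f y - (a + b * g y))\<^sup>2) = (\<lambda>y. f y * f y - 2 * a * f y - 2 * b * (f y * g y)
        + a\<^sup>2 + 2 * a * b * g y + b\<^sup>2 * (g y * g y))"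
      by (simp add: power2_eq_square algebra_simps)
    then have "?E (\<lambda>y. (f y - (a + b * g y))\<^sup>2)
      = ?E (\<lambda>y. f y * f y) - 2 * a * ?E f - 2 * b * ?E (\<lambda>y. f y * g y)
        + a\<^sup>2 + 2 * a * b * ?E g + b\<^sup>2 * ?E (\<lambda>y. g y * g y)"
      by (simp add: integrable_finite_pmf[OF fin])
    then show ?thesis
      unfolding covariance_eq[OF fin] a by (simp add: power2_eq_square algebra_simps)
  qed
  also have "\<dots> \<le> covariance q f f - 2 * b * covariance q f g + b\<^sup>2 * (1 / 4)"
    using g by (intro add_left_mono mult_left_mono) auto
  also have "\<dots> = covariance q f f - 4 * (covariance q f g)\<^sup>2"
    unfolding b by (simp add: power2_eq_square algebra_simps)
  finally show ?thesis .
qed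

subsection \<open>Conditioning on coordinates\<close>

definition agree :: "nat set \<Rightarrow> (nat \<Rightarrow> real) \<Rightarrow> (nat \<Rightarrow> real) set" where
  "agree J x = {y. \<forall>k\<in>J. y k = x k}"

lemma set_cond_agree:
  assumes "x \<in> set_pmf p"
  shows "set_pmf (cond_pmf p (agree J x)) = set_pmf p \<inter> agree J x"
  using assms by (intro set_cond_pmf) (auto simp: agree_def)

text \<open>This is the tower property: resampling a point within its class of agreement on
  \<open>J\<close> gives back the law \<open>p\<close>.\<close>

lemma expectation_cond_agree:
  fixes F :: "(nat \<Rightarrow> real) \<Rightarrow> real"
  assumes fin: "finite (set_pmf p)"
  shows "measure_pmf.expectation p (\<lambda>x. measure_pmf.expectation (cond_pmf p (agree J x)) F)
    = measure_pmf.expectation p F"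
proof -
  have "bind_pmf p (\<lambda>x. cond_pmf p {y. \<forall>k\<in>J. y k = x k}) = p"
  proof (rule bind_cond_pmf_cancel)
    fix x y :: "nat \<Rightarrow> real" assume "\<forall>k\<in>J. y k = x k"
    then have "{z. \<forall>k\<in>J. z k = x k} = {z. \<forall>k\<in>J. y k = z k}" by auto
    then show "measure_pmf.prob p {z. \<forall>k\<in>J. z k = x k}
        = measure_pmf.prob p {z. \<forall>k\<in>J. y k = z k}" by simp
  qed auto
  then have "measure_pmf.expectation p F
      = measure_pmf.expectation (bind_pmf p (\<lambda>x. cond_pmf p (agree J x))) F"
    by (simp add: agree_def)
  also have "\<dots> = (\<Sum>x\<in>set_pmf p. pmf p x * measure_pmf.expectation (cond_pmf p (agree J x)) F)"
    using fin by (subst pmf_expectation_bind[OF fin]) (auto simp: set_cond_agree)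
  also have "\<dots> = measure_pmf.expectation p
      (\<lambda>x. measure_pmf.expectation (cond_pmf p (agree J x)) F)"
    by (subst integral_measure_pmf[OF fin]) auto
  finally show ?thesis by simp
qed

lemma expectation_mono_pmf:
  fixes f g :: "'a \<Rightarrow> real"
  assumes "finite (set_pmf p)" "\<And>x. x \<in> set_pmf p \<Longrightarrow> f x \<le> g x"
  shows "measure_pmf.expectation p f \<le> measure_pmf.expectation p g"
  using assms by (intro integral_mono_AE integrable_finite_pmf) (auto simp: AE_measure_pmf_iff)

text \<open>This is E Var(f(X) | X_J), the mean squared error of the best prediction of f(X) from
  X_J.\<close>

definition mean_cond_var :: "(nat \<Rightarrow> real) pmf \<Rightarrow> ((nat \<Rightarrow> real) \<Rightarrow> real) \<Rightarrow> nat set \<Rightarrow> real" where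
  "mean_cond_var p f J = measure_pmf.expectation p (\<lambda>x. covariance (cond_pmf p (agree J x)) f f)"

lemma mean_cond_var_nonneg: "0 \<le> mean_cond_var p f J"
  unfolding mean_cond_var_def
  by (intro integral_nonneg_AE) (simp add: covariance_self_nonneg)

text \<open>Knowing X_J and X_k, the conditional mean predicts \<open>f\<close> at least as well as
  an affine function of X_k whose coefficients depend on X_J. The error of the latter is bounded by
  \<open>expectation_residual_le\<close>, since a binary X_k has conditional variance at most
  1/4.\<close>

lemma mean_cond_var_insert_le:
  assumes fin: "finite (set_pmf p)" and bin: "\<And>x. x \<in> set_pmf p \<Longrightarrow> x k \<in> {0, 1}"
  shows "mean_cond_var p f (insert k J) \<le> mean_cond_var p f J
    - 4 * measure_pmf.expectation p
        (\<lambda>x. (covariance (cond_pmf p (agree J x)) f (\<lambda>y. y k))\<^sup>2)"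
proof -
  define c where "c x J = cond_pmf p (agree J x)" for x J
  define b where "b = (\<lambda>x. 4 * covariance (c x J) f (\<lambda>y. y k))"
  define a where "a = (\<lambda>x. measure_pmf.expectation (c x J) f
    - b x * measure_pmf.expectation (c x J) (\<lambda>y. y k))"
  \<comment> \<open>The conditional law, and with it \<open>a\<close> and \<open>b\<close>, depends
    on the point only through its coordinates in \<open>J\<close>.\<close>
  have eq: "c y J = c x J" if "y \<in> agree J x" for x y
  proof -
    have "agree J y = agree J x" using that by (auto simp: agree_def)
    then show ?thesis by (simp add: c_def)
  qed
  have fc: "finite (set_pmf (c x K))" if "x \<in> set_pmf p" for x K
    using fin that by (simp add: c_def set_cond_agree)
  \<comment> \<open>The coefficients are taken at \<open>y\<close> itself, so \<open>R\<close> is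
    one function that does not refer to the conditioning point. Its mean can then be computed by
    conditioning on \<open>insert k J\<close> or on \<open>J\<close> alike.\<close>
  define R where "R = (\<lambda>y. (f y - (a y + b y * y k))\<^sup>2)"
  have "mean_cond_var p f (insert k J)
      \<le> measure_pmf.expectation p (\<lambda>x. measure_pmf.expectation (c x (insert k J)) R)"
    unfolding mean_cond_var_def c_def[symmetric]
  proof (rule expectation_mono_pmf[OF fin])
    fix x assume x: "x \<in> set_pmf p"
    have "measure_pmf.expectation (c x (insert k J)) (\<lambda>y. (f y - (a x + b x * x k))\<^sup>2)
        = measure_pmf.expectation (c x (insert k J)) R"
    proof (intro integral_cong_AE)
      show "AE y in c x (insert k J). (f y - (a x + b x * x k))\<^sup>2 = R y"
        unfolding AE_measure_pmf_iff
      proof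
        fix y assume "y \<in> set_pmf (c x (insert k J))"
        then have y: "y \<in> agree J x" "y k = x k"
          using x by (simp_all only: c_def set_cond_agree) (auto simp: agree_def)
        show "(f y - (a x + b x * x k))\<^sup>2 = R y"
          by (simp add: R_def a_def b_def eq[OF y(1)] y(2))
      qed
    qed auto
    then show "covariance (c x (insert k J)) f f \<le> measure_pmf.expectation (c x (insert k J)) R"
      using covariance_self_le[OF fc[OF x]] by metis
  qed
  also have "\<dots> = measure_pmf.expectation p (\<lambda>x. measure_pmf.expectation (c x J) R)"
    unfolding c_def expectation_cond_agree[OF fin] ..
  also have "\<dots> \<le> measure_pmf.expectation p (\<lambda>x. covariance (c x J) f f
      - 4 * (covariance (c x J) f (\<lambda>y. y k))\<^sup>2)"
  proof (rule expectation_mono_pmf[OF fin])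
    fix x assume x: "x \<in> set_pmf p"
    have "measure_pmf.expectation (c x J) R
        = measure_pmf.expectation (c x J) (\<lambda>y. (f y - (a x + b x * y k))\<^sup>2)"
    proof (intro integral_cong_AE)
      show "AE y in c x J. R y = (f y - (a x + b x * y k))\<^sup>2"
        unfolding AE_measure_pmf_iff
      proof
        fix y assume "y \<in> set_pmf (c x J)"
        then have y: "y \<in> agree J x" using x by (auto simp: c_def set_cond_agree)
        show "R y = (f y - (a x + b x * y k))\<^sup>2"
          by (simp add: R_def a_def b_def eq[OF y])
      qed
    qed auto
    also have "\<dots> \<le> covariance (c x J) f f - 4 * (covariance (c x J) f (\<lambda>y. y k))\<^sup>2"
    proof (rule expectation_residual_le)
      show "covariance (c x J) (\<lambda>y. y k) (\<lambda>y. y k) \<le> 1 / 4"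
      proof (rule covariance_self_binary_le[OF fc[OF x]])
        show "y k \<in> {0, 1}" if "y \<in> set_pmf (c x J)" for y
          using that x bin by (auto simp: c_def set_cond_agree)
      qed
    qed (auto simp: fc[OF x] a_def b_def)
    finally show "measure_pmf.expectation (c x J) R
      \<le> covariance (c x J) f f - 4 * (covariance (c x J) f (\<lambda>y. y k))\<^sup>2" .
  qed
  also have "\<dots> = mean_cond_var p f J - 4 * measure_pmf.expectation p
        (\<lambda>x. (covariance (cond_pmf p (agree J x)) f (\<lambda>y. y k))\<^sup>2)"
    unfolding mean_cond_var_def c_def by (simp add: integrable_finite_pmf[OF fin])
  finally show ?thesis .
qed


subsection \<open>Nonnegative correlation under \<open>MTP\<^sub>2\<close>\<close>

text \<open>Subsets encode points of the cube, so that min and max become intersection and union.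
  The restriction matches the extensional functions that make up \<open>cube n\<close>.\<close>

definition vertex :: "nat \<Rightarrow> nat set \<Rightarrow> nat \<Rightarrow> real" where
  "vertex n A = restrict (indicator A) {1..n}"

lemma finite_cube: "finite (cube n)"
  unfolding cube_def by (intro finite_PiE) auto

lemma vertex_in_cube: "vertex n A \<in> cube n"
  by (auto simp: vertex_def cube_def indicator_def)

lemma vertex_apply: "i \<in> {1..n} \<Longrightarrow> vertex n A i = indicator A i"
  by (simp add: vertex_def)

lemma bij_betw_vertex: "bij_betw (vertex n) (Pow {1..n}) (cube n)"
proof (rule bij_betw_byWitness[where f' = "\<lambda>x. {i \<in> {1..n}. x i = 1}"])
  show "\<forall>A\<in>Pow {1..n}. {i \<in> {1..n}. vertex n A i = 1} = A"
    by (auto simp: vertex_apply indicator_eq_1_iff)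
  show "\<forall>x\<in>cube n. vertex n {i \<in> {1..n}. x i = 1} = x"
  proof
    fix x assume x: "x \<in> cube n"
    show "vertex n {i \<in> {1..n}. x i = 1} = x"
    proof
      fix i
      show "vertex n {i \<in> {1..n}. x i = 1} i = x i"
        using x by (cases "i \<in> {1..n}")
          (auto simp: vertex_def cube_def indicator_def PiE_iff extensional_def)
    qed
  qed
qed (auto simp: vertex_in_cube)

lemma expectation_cube:
  fixes F :: "(nat \<Rightarrow> real) \<Rightarrow> real"
  assumes "set_pmf q \<subseteq> cube n"
  shows "measure_pmf.expectation q F = (\<Sum>A\<in>Pow {1..n}. pmf q (vertex n A) * F (vertex n A))"
proof -
  have "measure_pmf.expectation q F = (\<Sum>x\<in>cube n. pmf q x * F x)"
    using assms by (subst integral_measure_pmf[OF finite_cube]) auto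
  also have "\<dots> = (\<Sum>A\<in>Pow {1..n}. pmf q (vertex n A) * F (vertex n A))"
    by (rule sum.reindex_bij_betw[OF bij_betw_vertex, symmetric])
  finally show ?thesis .
qed

lemma mtp2_vertex:
  assumes "mtp2 n q"
  shows "pmf q (vertex n A) * pmf q (vertex n B) \<le> pmf q (vertex n (A \<union> B)) * pmf q (vertex n (A \<inter> B))"
proof -
  have "(\<lambda>i\<in>{1..n}. min (vertex n A i) (vertex n B i)) = vertex n (A \<inter> B)"
    "(\<lambda>i\<in>{1..n}. max (vertex n A i) (vertex n B i)) = vertex n (A \<union> B)"
    by (auto simp: vertex_def indicator_def fun_eq_iff)
  then show ?thesis
    using assms vertex_in_cube[of n A] vertex_in_cube[of n B]
    unfolding mtp2_def by (metis mult.commute)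
qed

text \<open>Let Pab be the probability of X_i = a and X_j = b. The covariance is P11 P00 - P10 P01,
  and the four functions theorem over the remaining coordinates shows that this is
  nonnegative.\<close>

lemma mtp2_covariance_nonneg:
  assumes supp: "set_pmf q \<subseteq> cube n" and q: "mtp2 n q"
    and ij: "i \<in> {1..n}" "j \<in> {1..n}" "i \<noteq> j"
  shows "0 \<le> covariance q (\<lambda>y. y i) (\<lambda>y. y j)"
proof -
  have fin: "finite (set_pmf q)" using supp finite_cube finite_subset by blast
  define w where "w = (\<lambda>A. pmf q (vertex n A))"
  define R where "R = {1..n} - {i, j}"
  have R: "{1..n} = insert i (insert j R)" "finite R" "j \<notin> R" "i \<notin> insert j R"
    using ij by (auto simp: R_def)
  define P00 where "P00 = (\<Sum>A\<in>Pow R. w A)"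
  define P01 where "P01 = (\<Sum>A\<in>Pow R. w (insert j A))"
  define P10 where "P10 = (\<Sum>A\<in>Pow R. w (insert i A))"
  define P11 where "P11 = (\<Sum>A\<in>Pow R. w (insert i (insert j A)))"
  have ex: "measure_pmf.expectation q F = (\<Sum>A\<in>Pow R. w A * F (vertex n A)
      + w (insert j A) * F (vertex n (insert j A))
      + (w (insert i A) * F (vertex n (insert i A))
      + w (insert i (insert j A)) * F (vertex n (insert i (insert j A)))))" for F
    unfolding expectation_cube[OF supp] R(1)
    using R(2-4) by (simp add: sum_Pow_insert sum.distrib w_def)
  have out: "i \<notin> A" "j \<notin> A" if "A \<subseteq> R" for A
    using that by (auto simp: R_def)
  note simps = ex vertex_apply[OF ij(1)] vertex_apply[OF ij(2)] out ij(3) ij(3)[symmetric]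
    sum.distrib P00_def[symmetric] P01_def[symmetric] P10_def[symmetric] P11_def[symmetric]
  have Ei: "measure_pmf.expectation q (\<lambda>y. y i) = P10 + P11"
    by (simp add: simps cong: sum.cong_simp)
  have Ej: "measure_pmf.expectation q (\<lambda>y. y j) = P01 + P11"
    by (simp add: simps cong: sum.cong_simp)
  have Eij: "measure_pmf.expectation q (\<lambda>y. y i * y j) = P11"
    by (simp add: simps cong: sum.cong_simp)
  have one: "P00 + P01 + P10 + P11 = 1"
    using ex[of "\<lambda>_. 1"] by (simp add: sum.distrib P00_def P01_def P10_def P11_def)
  \<comment> \<open>A set with \<open>i\<close> only and a set with \<open>j\<close> only have a
    union containing both and an intersection containing neither.\<close>
  have "P10 * P01 \<le> P11 * P00"
    unfolding P10_def P01_def P11_def P00_def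
  proof (rule four_functions[OF R(2)])
    fix A B assume AB: "A \<subseteq> R" "B \<subseteq> R"
    have "insert i A \<union> insert j B = insert i (insert j (A \<union> B))" by auto
    moreover have "insert i A \<inter> insert j B = A \<inter> B" using AB ij(3) by (auto simp: R_def)
    ultimately show "w (insert i A) * w (insert j B) \<le> w (insert i (insert j (A \<union> B))) * w (A \<inter> B)"
      using mtp2_vertex[OF q, of "insert i A" "insert j B"] unfolding w_def by simp
  qed (auto simp: w_def)
  \<comment> \<open>The factor equal to one makes the expression homogeneous of degree two, so that
    the other products cancel.\<close>
  moreover have "covariance q (\<lambda>y. y i) (\<lambda>y. y j)
      = P11 * (P00 + P01 + P10 + P11) - (P10 + P11) * (P01 + P11)"
    unfolding covariance_eq[OF fin] Ei Ej Eij one by simp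
  ultimately show ?thesis by (simp add: algebra_simps)
qed

text \<open>The points that agree with \<open>x\<close> on \<open>J\<close> are closed under
  coordinatewise min and max, and conditioning divides both sides by the same \<open>m * m\<close>.
  If one of the two given points lies outside this set, the product to be bounded is zero.\<close>

lemma mtp2_cond_agree:
  assumes q: "mtp2 n q" and J: "J \<subseteq> {1..n}" and x: "x \<in> set_pmf q"
  shows "mtp2 n (cond_pmf q (agree J x))"
proof -
  have ne: "set_pmf q \<inter> agree J x \<noteq> {}" using x by (auto simp: agree_def)
  define m where "m = measure_pmf.prob q (agree J x)"
  have pmf: "pmf (cond_pmf q (agree J x)) y = (if y \<in> agree J x then pmf q y / m else 0)" for y
    unfolding m_def by (rule pmf_cond[OF ne])
  show ?thesis
    unfolding mtp2_def
  proof (intro ballI)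
    fix y z assume yz: "y \<in> cube n" "z \<in> cube n"
    let ?u = "\<lambda>i\<in>{1..n}. min (y i) (z i)" and ?v = "\<lambda>i\<in>{1..n}. max (y i) (z i)"
    show "pmf (cond_pmf q (agree J x)) y * pmf (cond_pmf q (agree J x)) z
      \<le> pmf (cond_pmf q (agree J x)) ?u * pmf (cond_pmf q (agree J x)) ?v"
    proof (cases "y \<in> agree J x \<and> z \<in> agree J x")
      case True
      then have "?u \<in> agree J x" "?v \<in> agree J x"
        using J by (auto simp: agree_def subset_iff)
      moreover have "pmf q y * pmf q z / (m * m) \<le> pmf q ?u * pmf q ?v / (m * m)"
        using q yz by (intro divide_right_mono) (auto simp: mtp2_def)
      ultimately show ?thesis using True by (simp add: pmf)
    next
      case False
      then have "pmf (cond_pmf q (agree J x)) y * pmf (cond_pmf q (agree J x)) z = 0"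
        by (auto simp: pmf)
      then show ?thesis by (metis mult_nonneg_nonneg pmf_nonneg)
    qed
  qed
qed

lemma flip_in_cube: "x \<in> cube n \<Longrightarrow> flip n e x \<in> cube n"
  by (auto simp: flip_def cube_def PiE_iff)

lemma cond_cov_eq: "cond_cov p i j J x = covariance (cond_pmf p (agree J x)) (\<lambda>y. y i) (\<lambda>y. y j)"
  by (simp add: cond_cov_def agree_def)

text \<open>Flipping commutes with conditioning on coordinates, so the flipped conditional law is
  again MTP2 and its covariances are nonnegative. Undoing the flips multiplies a covariance by the
  two signs.\<close>

lemma flip_mtp2_cond_cov_nonneg:
  fixes e :: "nat \<Rightarrow> nat"
  defines "s \<equiv> \<lambda>i. if e i = 0 then 1 else - 1"
  assumes supp: "set_pmf p \<subseteq> cube n" and mtp2: "mtp2 n (map_pmf (flip n e) p)"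
    and x: "x \<in> set_pmf p" and J: "J \<subseteq> {1..n}"
    and ij: "i \<in> {1..n}" "j \<in> {1..n}" "i \<noteq> j"
  shows "0 \<le> s i * s j * cond_cov p i j J x"
proof -
  define c where "c = cond_pmf p (agree J x)"
  have c: "set_pmf c = set_pmf p \<inter> agree J x"
    unfolding c_def by (rule set_cond_agree[OF x])
  have fin: "finite (set_pmf c)"
    unfolding c using supp finite_cube finite_subset by blast
  have pre: "flip n e -` agree J (flip n e x) = agree J x"
  proof -
    have "flip n e y k = flip n e x k \<longleftrightarrow> y k = x k" if "k \<in> J" for y k
      using J that by (auto simp: flip_def)
    then show ?thesis by (auto simp: agree_def)
  qed
  have "cond_pmf (map_pmf (flip n e) p) (agree J (flip n e x)) = map_pmf (flip n e) c"
    unfolding c_def using x by (subst cond_map_pmf) (simp_all add: pre, auto simp: agree_def)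
  then have "mtp2 n (map_pmf (flip n e) c)"
    using mtp2_cond_agree[OF mtp2 J, of "flip n e x"] x by simp
  moreover have "set_pmf (map_pmf (flip n e) c) \<subseteq> cube n"
    using supp flip_in_cube c by auto
  ultimately have "0 \<le> covariance (map_pmf (flip n e) c) (\<lambda>y. y i) (\<lambda>y. y j)"
    using ij by (intro mtp2_covariance_nonneg)
  \<comment> \<open>A flipped coordinate 1 - y_i has the affine form
    \<open>s i * y i + 1\<close>.\<close>
  also have "\<dots> = covariance c (\<lambda>y. s i * y i + (if e i = 0 then 0 else 1))
      (\<lambda>y. s j * y j + (if e j = 0 then 0 else 1))"
    unfolding covariance_map_pmf using ij
    by (intro covariance_cong) (auto simp: flip_def s_def)
  also have "\<dots> = s i * s j * cond_cov p i j J x"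
    unfolding cond_cov_eq c_def[symmetric] by (rule covariance_affine[OF fin])
  finally show ?thesis .
qed

subsection \<open>Decay of the average conditional variance\<close>

text \<open>Double counting: the pair \<open>(J, k)\<close> corresponds to
  \<open>(insert k J, k)\<close>, and a set of size \<open>t + 1\<close> arises once for each of its
  elements.\<close>

lemma sum_subsets_insert:
  fixes g :: "nat set \<Rightarrow> real"
  shows "(\<Sum>J\<in>{J. J \<subseteq> {1..n} \<and> card J = t}. \<Sum>k\<in>{1..n} - J. g (insert k J))
    = real (t + 1) * (\<Sum>K\<in>{K. K \<subseteq> {1..n} \<and> card K = t + 1}. g K)"
proof -
  let ?N = "\<lambda>t. {J. J \<subseteq> {1..n} \<and> card J = t}"
  have finN: "finite (?N t)" for t by simp
  have finJ: "finite J" if "J \<in> ?N t" for J t using that finite_subset by blast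
  have "(\<Sum>J\<in>?N t. \<Sum>k\<in>{1..n} - J. g (insert k J))
      = (\<Sum>(J, k)\<in>Sigma (?N t) (\<lambda>J. {1..n} - J). g (insert k J))"
    by (rule sum.Sigma) auto
  also have "\<dots> = (\<Sum>(K, k)\<in>Sigma (?N (t + 1)) (\<lambda>K. K). g K)"
  proof (rule sum.reindex_bij_witness[where i = "\<lambda>(K, k). (K - {k}, k)"
        and j = "\<lambda>(J, k). (insert k J, k)"], goal_cases)
    case (1 a)
    then show ?case by auto
  next
    case (2 a)
    then obtain J k where a: "a = (J, k)" "J \<subseteq> {1..n}" "card J = t" "k \<in> {1..n}" "k \<notin> J"
      by auto
    moreover have "finite J" using a(2) by (rule finite_subset) simp
    ultimately show ?case by simp
  next
    case (3 b)
    then show ?case by (auto simp: insert_absorb)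
  next
    case (4 b)
    then obtain K k where b: "b = (K, k)" "K \<subseteq> {1..n}" "card K = t + 1" "k \<in> K"
      by auto
    moreover have "K - {k} \<subseteq> {1..n}" "k \<in> {1..n}" using b by auto
    ultimately show ?case by simp
  next
    case (5 a)
    then show ?case by (simp add: split_beta)
  qed
  also have "\<dots> = (\<Sum>K\<in>?N (t + 1). \<Sum>k\<in>K. g K)"
    using finJ by (intro sum.Sigma[symmetric]) auto
  also have "\<dots> = (\<Sum>K\<in>?N (t + 1). real (t + 1) * g K)"
    by (intro sum.cong) auto
  finally show ?thesis by (simp add: sum_distrib_left)
qed

section \<open>Averages and a quadratic recursion\<close>

lemma avg_mono:
  assumes "\<And>a. a \<in> A \<Longrightarrow> f a \<le> g a"
  shows "avg A f \<le> avg A g"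
  unfolding avg_def using assms by (intro divide_right_mono sum_mono) auto

lemma avg_square_le:
  shows "(avg A f)\<^sup>2 \<le> avg A (\<lambda>a. (f a)\<^sup>2)"
\<comment> \<open>Cardinality zero covers empty and infinite sets; both averages are then quotients
  by zero, hence 0.\<close>
proof (cases "card A = 0")
  case True
  then show ?thesis by (simp add: avg_def)
next
  case False
  then have "(sum f A)\<^sup>2 \<le> (\<Sum>a\<in>A. (f a)\<^sup>2) * card A"
    by (intro sum_squared_le_sum_of_squares)
  then show ?thesis using False
    by (simp add: avg_def power_divide power2_eq_square field_simps)
qed

text \<open>The bound \<open>b - b\<^sup>2 \<le> b / (1 + b)\<close> says that the reciprocal of a
  positive \<open>b\<close> grows by at least 1 in each step.\<close>

lemma reciprocal_decay:
  fixes b b' :: real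
  assumes "0 \<le> b" "b' \<le> b - b\<^sup>2" "b \<le> 1 / real (t + 1)"
  shows "b' \<le> 1 / real (t + 2)"
proof (cases "b = 0")
  case True
  then have "b' \<le> 0" using assms(2) by simp
  also have "0 \<le> 1 / real (t + 2)" by simp
  finally show ?thesis .
next
  case False
  then have b: "b > 0" using assms(1) by simp
  have "(b - b\<^sup>2) * (1 + b) \<le> b"
    using b by (simp add: algebra_simps power2_eq_square power3_eq_cube)
  then have "b - b\<^sup>2 \<le> b / (1 + b)" using b by (simp add: pos_le_divide_eq)
  also have "\<dots> \<le> 1 / real (t + 2)"
  proof -
    have "b * real (t + 1) \<le> 1" using assms(3) by (simp add: field_simps)
    then show ?thesis using b by (simp add: field_simps)
  qed
  finally show ?thesis using assms(2) by linarith
qed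

section \<open>Laws whose conditional covariances have a fixed sign pattern\<close>

text \<open>This isolates what the rest of the argument takes from signed MTP2: one choice of signs
  that works for every conditioning set and every outcome.\<close>

locale signed_cube_law =
  fixes n :: nat and p :: "(nat \<Rightarrow> real) pmf" and s :: "nat \<Rightarrow> real"
  assumes supp: "set_pmf p \<subseteq> cube n"
    and sign: "s i * s i = 1"
    and pos: "\<lbrakk>x \<in> set_pmf p; J \<subseteq> {1..n}; i \<in> {1..n}; j \<in> {1..n}; i \<noteq> j\<rbrakk>
      \<Longrightarrow> 0 \<le> s i * s j * cond_cov p i j J x"
begin

definition S :: "(nat \<Rightarrow> real) \<Rightarrow> real" where
  "S y = (\<Sum>i\<in>{1..n}. s i * y i)"

abbreviation V :: "nat set \<Rightarrow> real" where
  "V \<equiv> mean_cond_var p S"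

definition level :: "nat \<Rightarrow> nat set set" where
  "level t = {J. J \<subseteq> {1..n} \<and> card J = t}"

lemma fin: "finite (set_pmf p)"
  using supp finite_cube finite_subset by blast

lemma abs_sign: "\<bar>s i\<bar> = 1"
  using sign[of i] by (metis abs_square_eq_1 power2_eq_square)

lemma fin_cond: "x \<in> set_pmf p \<Longrightarrow> finite (set_pmf (cond_pmf p (agree J x)))"
  using fin by (simp add: set_cond_agree)

text \<open>Coordinates in \<open>J\<close> are constant under the conditional law and contribute
  nothing.\<close>

lemma covariance_S_cond:
  assumes x: "x \<in> set_pmf p" and J: "J \<subseteq> {1..n}"
  shows "covariance (cond_pmf p (agree J x)) f S
    = (\<Sum>i\<in>{1..n} - J. s i * covariance (cond_pmf p (agree J x)) f (\<lambda>y. y i))"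
proof -
  let ?c = "cond_pmf p (agree J x)"
  have "covariance ?c f S = (\<Sum>i\<in>{1..n}. covariance ?c f (\<lambda>y. s i * y i))"
    unfolding S_def by (rule covariance_sum_right[OF fin_cond[OF x]])
  also have "\<dots> = (\<Sum>i\<in>{1..n}. s i * covariance ?c f (\<lambda>y. y i))"
    using covariance_affine[OF fin_cond[OF x], where a = 1 and b = 0 and d = 0] by simp
  also have "\<dots> = (\<Sum>i\<in>{1..n} - J. s i * covariance ?c f (\<lambda>y. y i))"
  proof (rule sum.mono_neutral_right)
    have "covariance ?c f (\<lambda>y. y i) = 0" if "i \<in> J" for i
      using that by (intro covariance_const[where c = "x i"])
        (simp add: set_cond_agree[OF x], simp add: agree_def)
    then show "\<forall>i\<in>{1..n} - ({1..n} - J). s i * covariance ?c f (\<lambda>y. y i) = 0" by auto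
  qed auto
  finally show ?thesis .
qed

text \<open>The numbers \<open>a k\<close> sum up to \<open>V J\<close>, and revealing
  \<open>k\<close> lowers \<open>V J\<close> by at least \<open>4 * (a k)\<^sup>2\<close>;
  Cauchy-Schwarz bounds the sum of these squares from below.\<close>

lemma variance_decrement:
  assumes J: "J \<subseteq> {1..n}"
  shows "(\<Sum>k\<in>{1..n} - J. V (insert k J)) \<le> real (n - card J) * (V J - 4 / n\<^sup>2 * (V J)\<^sup>2)"
proof -
  define m where "m = card ({1..n} - J)"
  have m: "m = n - card J"
    unfolding m_def using J by (simp add: card_Diff_subset finite_subset)
  define C where "C k x = covariance (cond_pmf p (agree J x)) S (\<lambda>y. y k)" for k x
  define a where "a k = measure_pmf.expectation p (\<lambda>x. s k * C k x)" for k
  have VJ: "V J = sum a ({1..n} - J)"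
  proof -
    have "V J = measure_pmf.expectation p (\<lambda>x. \<Sum>k\<in>{1..n} - J. s k * C k x)"
      unfolding mean_cond_var_def C_def using covariance_S_cond[OF _ J]
      by (intro integral_cong_AE) (auto simp: AE_measure_pmf_iff)
    then show ?thesis
      unfolding a_def by (simp add: integrable_finite_pmf[OF fin])
  qed
  have step: "V (insert k J) \<le> V J - 4 * (a k)\<^sup>2" if k: "k \<in> {1..n}" for k
  proof -
    \<comment> \<open>The square of a mean is at most the mean of the square, as the variance is
      nonnegative.\<close>
    have "(a k)\<^sup>2 \<le> measure_pmf.expectation p (\<lambda>x. (s k * C k x)\<^sup>2)"
      using covariance_self_nonneg[of p "\<lambda>x. s k * C k x"]
      unfolding covariance_eq[OF fin] a_def by (simp add: power2_eq_square)
    also have "\<dots> = measure_pmf.expectation p (\<lambda>x. (C k x)\<^sup>2)"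
      using sign[of k] by (simp add: power_mult_distrib flip: power2_eq_square)
    finally have "(a k)\<^sup>2 \<le> measure_pmf.expectation p (\<lambda>x. (C k x)\<^sup>2)" .
    moreover have "x k \<in> {0, 1}" if "x \<in> set_pmf p" for x
      using subsetD[OF supp that] k by (auto simp: cube_def PiE_iff)
    ultimately show ?thesis
      using mean_cond_var_insert_le[OF fin, of k S J] unfolding C_def by fastforce
  qed
  show ?thesis
  proof (cases "m = 0")
    case True
    then have "{1..n} - J = {}" by (simp add: m_def)
    then show ?thesis using True m by (metis mult_zero_left of_nat_0 order_refl sum.empty)
  next
    case False
    define r where "r = m * ((V J)\<^sup>2 / n\<^sup>2)"
    have "(V J)\<^sup>2 \<le> (\<Sum>k\<in>{1..n} - J. (a k)\<^sup>2) * m"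
      unfolding VJ m_def by (rule sum_squared_le_sum_of_squares)
    \<comment> \<open>Weakening \<open>m\<close> to \<open>n\<close> gives a decay rate that is the
      same for all sizes of \<open>J\<close>.\<close>
    moreover have "(\<Sum>k\<in>{1..n} - J. (a k)\<^sup>2) * m * m \<le> (\<Sum>k\<in>{1..n} - J. (a k)\<^sup>2) * n\<^sup>2"
    proof -
      have "real m * real m \<le> (real n)\<^sup>2" using m by (simp add: power2_eq_square mult_mono)
      then show ?thesis by (simp add: mult.assoc mult_left_mono sum_nonneg)
    qed
    ultimately have "(V J)\<^sup>2 * m \<le> (\<Sum>k\<in>{1..n} - J. (a k)\<^sup>2) * n\<^sup>2"
      using mult_right_mono[of "(V J)\<^sup>2" _ "real m"] by fastforce
    moreover have "n > 0" using False m by simp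
    ultimately have "r \<le> (\<Sum>k\<in>{1..n} - J. (a k)\<^sup>2)"
      by (simp add: r_def field_simps)
    moreover have "(\<Sum>k\<in>{1..n} - J. V (insert k J)) \<le> (\<Sum>k\<in>{1..n} - J. V J - 4 * (a k)\<^sup>2)"
      using step by (intro sum_mono) auto
    moreover have "\<dots> = m * V J - 4 * (\<Sum>k\<in>{1..n} - J. (a k)\<^sup>2)"
      by (simp add: sum_subtractf sum_distrib_left m_def)
    moreover have "m * (V J - 4 / n\<^sup>2 * (V J)\<^sup>2) = m * V J - 4 * r"
      by (simp add: r_def algebra_simps)
    ultimately show ?thesis
      unfolding m[symmetric] by linarith
  qed
qed

text \<open>Summing \<open>variance_decrement\<close> over a level counts every set of the next
  level \<open>t + 1\<close> times. The average of squares that appears is at least the square of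
  the average.\<close>

lemma avg_variance_step:
  assumes t: "t < n"
  shows "avg (level (t + 1)) V \<le> avg (level t) V - 4 / n\<^sup>2 * (avg (level t) V)\<^sup>2"
proof -
  define N where "N = real (card (level t))"
  define N' where "N' = real (card (level (t + 1)))"
  have cardN: "card (level r) = n choose r" for r
    using n_subsets[of "{1..n}" r] by (simp add: level_def)
  have N0: "N > 0" "N' > 0" unfolding N_def N'_def cardN using t by simp_all
  \<comment> \<open>Counting pairs with the constant function 1 relates the sizes of the two levels
    and turns the sums into averages.\<close>
  have "real (n - t) * N = (\<Sum>J\<in>level t. \<Sum>k\<in>{1..n} - J. 1)"
  proof -
    have "card ({1..n} - J) = n - t" if "J \<in> level t" for J
      using that by (auto simp: level_def card_Diff_subset finite_subset[of _ "{1..n}"])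
    then show ?thesis by (simp add: N_def)
  qed
  also have "\<dots> = real (t + 1) * N'"
    unfolding level_def by (subst sum_subsets_insert) (simp add: N'_def level_def)
  finally have NN: "real (n - t) * N = real (t + 1) * N'" .
  have "real (t + 1) * sum V (level (t + 1)) = (\<Sum>J\<in>level t. \<Sum>k\<in>{1..n} - J. V (insert k J))"
    unfolding level_def by (rule sum_subsets_insert[symmetric])
  also have "\<dots> \<le> (\<Sum>J\<in>level t. real (n - t) * (V J - 4 / n\<^sup>2 * (V J)\<^sup>2))"
    using variance_decrement by (intro sum_mono) (auto simp: level_def)
  also have "\<dots> = real (n - t) * N * (avg (level t) V - 4 / n\<^sup>2 * avg (level t) (\<lambda>J. (V J)\<^sup>2))"
  proof -
    have 1: "(\<Sum>J\<in>level t. real (n - t) * (V J - 4 / n\<^sup>2 * (V J)\<^sup>2))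
        = real (n - t) * (sum V (level t) - 4 / n\<^sup>2 * (\<Sum>J\<in>level t. (V J)\<^sup>2))"
      by (simp only: sum_distrib_left[symmetric] sum_subtractf)
    have 2: "real (n - t) * (x - c * y) = real (n - t) * N * (x / N - c * (y / N))" for x y c
      using N0 by (simp add: field_simps)
    show ?thesis unfolding avg_def N_def[symmetric] by (rule trans[OF 1 2])
  qed
  also have "\<dots> \<le> real (n - t) * N * (avg (level t) V - 4 / n\<^sup>2 * (avg (level t) V)\<^sup>2)"
    using N0 by (intro mult_left_mono diff_left_mono avg_square_le) auto
  finally have "real (t + 1) * sum V (level (t + 1))
      \<le> real (n - t) * N * (avg (level t) V - 4 / n\<^sup>2 * (avg (level t) V)\<^sup>2)" .
  moreover have "sum V (level (t + 1)) = N' * avg (level (t + 1)) V"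
    using N0 by (simp add: avg_def N'_def)
  ultimately have "real (t + 1) * N' * avg (level (t + 1)) V
      \<le> real (t + 1) * N' * (avg (level t) V - 4 / n\<^sup>2 * (avg (level t) V)\<^sup>2)"
    by (simp only: NN mult.assoc)
  then show ?thesis using N0 by (simp add: mult_le_cancel_left_pos)
qed

lemma avg_variance_nonneg: "0 \<le> avg (level t) V"
  unfolding avg_def by (intro divide_nonneg_nonneg sum_nonneg mean_cond_var_nonneg) auto

lemma avg_variance_le:
  assumes "t < n"
  shows "avg (level t) V \<le> n\<^sup>2 / (4 * real (t + 1))"
proof -
  \<comment> \<open>This scaling turns the decrement into
    \<open>b (t + 1) \<le> b t - (b t)\<^sup>2\<close>.\<close>
  define b where "b t = 4 / n\<^sup>2 * avg (level t) V" for t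
  have n: "n > 0" using assms by simp
  have b0: "0 \<le> b t" for t
    unfolding b_def by (intro mult_nonneg_nonneg avg_variance_nonneg) simp
  have step: "b (t + 1) \<le> b t - (b t)\<^sup>2" if "t < n" for t
    using mult_left_mono[OF avg_variance_step[OF that], of "4 / n\<^sup>2"]
    by (simp add: b_def algebra_simps power2_eq_square)
  have "b t \<le> 1 / real (t + 1)"
    using assms
  proof (induction t)
    case 0
    \<comment> \<open>The start comes from the recursion itself: as \<open>b 1\<close> is
      nonnegative, the square of \<open>b 0\<close> is at most \<open>b 0\<close>, so
      \<open>b 0 \<le> 1\<close>.\<close>
    have "b 0 * b 0 \<le> b 0 * 1" using step[of 0] b0[of 1] n by (simp add: power2_eq_square)
    then show ?case using b0[of 0] by (cases "b 0 = 0") (auto simp: mult_le_cancel_left)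
  next
    case (Suc t)
    then show ?case using reciprocal_decay[OF b0 step, of t t] by simp
  qed
  then show ?thesis using n by (simp add: b_def field_simps)
qed

section \<open>From conditional variance to absolute covariances\<close>

text \<open>Expanding Var(S | X_J) gives signed covariances over all pairs outside \<open>J\<close>.
  The diagonal terms are variances and may be dropped; the others equal their absolute values. The
  denominator counts the ordered pairs, and if there are none both sides are 0.\<close>

lemma avg_pairs_le:
  assumes J: "J \<subseteq> {1..n}"
  shows "avg {(i, j). i \<in> {1..n} - J \<and> j \<in> {1..n} - J \<and> i \<noteq> j}
      (\<lambda>(i, j). measure_pmf.expectation p (\<lambda>x. \<bar>cond_cov p i j J x\<bar>))
    \<le> V J / (real (n - card J) * real (n - card J - 1))"
proof -
  define I where "I = {1..n} - J"
  define D where "D = {(i, j). i \<in> I \<and> j \<in> I \<and> i \<noteq> j}"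
  have I: "finite I" "card I = n - card J"
    unfolding I_def using J by (simp_all add: card_Diff_subset finite_subset)
  have D: "D = I \<times> I - (\<lambda>i. (i, i)) ` I" by (auto simp: D_def)
  have finD: "finite D" unfolding D using I by simp
  have cardD: "card D = card I * (card I - 1)"
  proof -
    have "card ((\<lambda>i. (i, i)) ` I) = card I" by (rule card_image) (simp add: inj_on_def)
    then show ?thesis
      unfolding D using I(1)
      by (subst card_Diff_subset) (auto simp: card_cartesian_product diff_mult_distrib2)
  qed
  have "(\<Sum>(i, j)\<in>D. measure_pmf.expectation p (\<lambda>x. \<bar>cond_cov p i j J x\<bar>))
      = measure_pmf.expectation p (\<lambda>x. \<Sum>(i, j)\<in>D. \<bar>cond_cov p i j J x\<bar>)"
    by (simp add: split_beta integrable_finite_pmf[OF fin])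
  also have "\<dots> \<le> V J"
    unfolding mean_cond_var_def
  proof (rule expectation_mono_pmf[OF fin])
    fix x assume x: "x \<in> set_pmf p"
    let ?c = "cond_pmf p (agree J x)"
    have "covariance ?c S S = (\<Sum>i\<in>I. s i * (\<Sum>j\<in>I. s j * cond_cov p i j J x))"
    proof -
      have "covariance ?c S (\<lambda>y. y i) = (\<Sum>j\<in>I. s j * cond_cov p i j J x)" for i
        by (subst covariance_commute) (simp add: covariance_S_cond[OF x J, folded I_def] cond_cov_eq)
      then show ?thesis by (simp add: covariance_S_cond[OF x J, folded I_def])
    qed
    also have "\<dots> = (\<Sum>(i, j)\<in>I \<times> I. s i * s j * cond_cov p i j J x)"
      by (simp add: sum_distrib_left sum.cartesian_product mult.assoc)
    finally have "covariance ?c S S = (\<Sum>(i, j)\<in>I \<times> I. s i * s j * cond_cov p i j J x)" .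
    moreover have "(\<Sum>(i, j)\<in>D. s i * s j * cond_cov p i j J x)
        \<le> (\<Sum>(i, j)\<in>I \<times> I. s i * s j * cond_cov p i j J x)"
    proof (rule sum_mono2)
      show "0 \<le> (case b of (i, j) \<Rightarrow> s i * s j * cond_cov p i j J x)" if "b \<in> I \<times> I - D" for b
        using that by (auto simp: D_def sign cond_cov_eq covariance_self_nonneg)
    qed (use I in \<open>auto simp: D_def\<close>)
    moreover have "(\<Sum>(i, j)\<in>D. s i * s j * cond_cov p i j J x) = (\<Sum>(i, j)\<in>D. \<bar>cond_cov p i j J x\<bar>)"
    proof (rule sum.cong[OF refl], clarify)
      fix i j assume "(i, j) \<in> D"
      then have "0 \<le> s i * s j * cond_cov p i j J x"
        using pos[OF x J, of i j] by (simp add: D_def I_def)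
      then show "s i * s j * cond_cov p i j J x = \<bar>cond_cov p i j J x\<bar>"
        by (metis abs_mult abs_of_nonneg abs_sign mult_1)
    qed
    ultimately show "(\<Sum>(i, j)\<in>D. \<bar>cond_cov p i j J x\<bar>) \<le> covariance ?c S S" by simp
  qed
  finally show ?thesis
    unfolding avg_def I_def[symmetric] D_def[symmetric] cardD I(2)[symmetric] of_nat_mult
    by (intro divide_right_mono) auto
qed

lemma avgCov_le_avg_variance:
  "avgCov n p t \<le> avg (level t) V / (real (n - t) * real (n - t - 1))"
proof -
  have "avgCov n p t \<le> avg (level t) (\<lambda>J. V J / (real (n - t) * real (n - t - 1)))"
    unfolding avgCov_def level_def using avg_pairs_le by (intro avg_mono) auto
  then show ?thesis by (simp add: avg_def sum_divide_distrib[symmetric] mult_ac)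
qed

lemma avgCov_le:
  assumes t: "2 * t + 2 \<le> n"
  shows "avgCov n p t \<le> 1 / real (t + 1)"
proof -
  have nn: "(real n)\<^sup>2 \<le> 4 * (real (n - t) * real (n - t - 1))"
  proof -
    \<comment> \<open>The bound on the second factor is exactly \<open>2 * t + 2 \<le> n\<close>. At
      least a quarter of \<open>n\<^sup>2\<close> ordered pairs thus remain, which cancels the
      factor in \<open>avg_variance_le\<close>.\<close>
    have "n * n \<le> (2 * (n - t)) * (2 * (n - t - 1))"
      using t by (intro mult_mono) auto
    then have "real (n * n) \<le> real ((2 * (n - t)) * (2 * (n - t - 1)))"
      by (rule of_nat_mono)
    then show ?thesis by (simp only: of_nat_mult power2_eq_square)
  qed
  have ratio: "x / (4 * r) / d \<le> 1 / r" if "x \<le> 4 * d" "0 < d" "0 < r" for x d r :: real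
    using that by (simp add: field_simps)
  have D: "0 < real (n - t) * real (n - t - 1)" using t by simp
  have "n\<^sup>2 / (4 * real (t + 1)) / (real (n - t) * real (n - t - 1)) \<le> 1 / real (t + 1)"
    unfolding of_nat_power by (rule ratio[OF nn D]) simp
  moreover have "avgCov n p t \<le> n\<^sup>2 / (4 * real (t + 1)) / (real (n - t) * real (n - t - 1))"
    using avgCov_le_avg_variance[of t] D t
      divide_right_mono[OF avg_variance_le[of t], of "real (n - t) * real (n - t - 1)"]
    by linarith
  ultimately show ?thesis by (rule order_trans[rotated])
qed

end

section \<open>The choice of t\<close>

text \<open>Revealing everything leaves no pair, and an empty average is 0. This serves the case
  where \<open>n\<close> is small compared with 1 / \<epsilon>.\<close>

lemma avgCov_full: "avgCov n p n = 0"
proof -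
  have "avg {(i, j). i \<in> {1..n} - J \<and> j \<in> {1..n} - J \<and> i \<noteq> j} f = 0"
    if "J \<subseteq> {1..n}" "card J = n" for J and f :: "nat \<times> nat \<Rightarrow> real"
  proof -
    have "J = {1..n}" using that by (intro card_subset_eq) auto
    then show ?thesis by (simp add: avg_def)
  qed
  then show ?thesis unfolding avgCov_def avg_def[of "{J. J \<subseteq> {1..n} \<and> card J = n}"]
    by (subst sum.neutral) auto
qed

theorem mainTheorem3:
  shows "\<exists>C::real. C > 0 \<and>
    (\<forall>(n::nat) (p :: (nat \<Rightarrow> real) pmf).
       set_pmf p \<subseteq> cube n \<and> signed_mtp2 n p \<longrightarrow>
       (\<forall>\<epsilon>::real. \<epsilon> > 0 \<longrightarrow>
          (\<exists>t::nat. t \<le> n \<and> real t \<le> C / \<epsilon> \<and> avgCov n p t \<le> \<epsilon>)))"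
\<comment> \<open>The constant 3 comes from the fallback \<open>t = n\<close>: there n \<le> 2 t + 1
  \<le> 3 t for the rounded value t \<ge> 1 of 1 / \<epsilon>.\<close>
proof (rule exI[of _ 3], intro conjI allI impI)
  fix n :: nat and p :: "(nat \<Rightarrow> real) pmf" and \<epsilon> :: real
  assume p: "set_pmf p \<subseteq> cube n \<and> signed_mtp2 n p" and \<epsilon>: "\<epsilon> > 0"
  then obtain e where e: "mtp2 n (map_pmf (flip n e) p)"
    by (auto simp: signed_mtp2_def)
  define s :: "nat \<Rightarrow> real" where "s i = (if e i = 0 then 1 else - 1)" for i
  interpret signed_cube_law n p s
    by standard (use p flip_mtp2_cond_cov_nonneg[OF _ e] in \<open>auto simp: s_def\<close>)
  \<comment> \<open>Rounding down keeps t \<le> 1 / \<epsilon>, while 1 / \<epsilon> < t + 1 makes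
    the bound 1 / (t + 1) at most \<epsilon>.\<close>
  define t where "t = nat \<lfloor>1 / \<epsilon>\<rfloor>"
  have t1: "real t \<le> 1 / \<epsilon>" using \<epsilon> by (simp add: t_def)
  have "1 / \<epsilon> < real t + 1" using \<epsilon> unfolding t_def by simp
  then have t2: "1 / real (t + 1) \<le> \<epsilon>" using \<epsilon> by (simp add: field_simps)
  have C: "3 / \<epsilon> = 3 * (1 / \<epsilon>)" by simp
  show "\<exists>t\<le>n. real t \<le> 3 / \<epsilon> \<and> avgCov n p t \<le> \<epsilon>"
  proof (cases "2 * t + 2 \<le> n")
    case True
    then have "avgCov n p t \<le> \<epsilon>" using avgCov_le t2 by fastforce
    moreover have "real t \<le> 3 / \<epsilon>" using t1 \<epsilon> unfolding C by linarith
    ultimately show ?thesis using True by (intro exI[of _ t]) auto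
  next
    case False
    show ?thesis
    proof (cases "t = 0")
      case True
      then have "n \<le> 1" using False by simp
      \<comment> \<open>With at most one coordinate the number of pairs is 0, so the bound on
        \<open>avgCov\<close> is a quotient by zero, that is 0.\<close>
      then have "avgCov n p 0 \<le> 0"
        using avgCov_le_avg_variance[of 0] by (cases "n = 0") auto
      then show ?thesis using \<epsilon> by (intro exI[of _ 0]) auto
    next
      case tn: False
      then have "real n \<le> 3 * real t" using False by linarith
      then have "real n \<le> 3 / \<epsilon>" using t1 unfolding C by linarith
      then show ?thesis using avgCov_full \<epsilon> by (intro exI[of _ n]) auto
    qed
  qed
qed simp

end
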